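(* Let $n\ge 2$, $\mathcal N=\{1,\dots,n\}$, $\bm\delta\in(0,1)^n$, and suppose that for each $i\in\mathcal N$ the functions $f_i,c_i:[0,\infty)\to[0,\infty)$ are twice differentiable on $(0,+\infty)$ with $f_i(0)=0$, $f_i'>0$, $f_i''\le 0$, $c_i(0)=0$, $c_i'>0$, $c_i''\ge 0$. Let $\Lambda(\bm x,\bm p)$ be a real-valued objective function of effort profiles $\bm x\in\mathbb R_+^n$ and recognition probability profiles $\bm p$ (probability vectors in $\mathbb R^n$) such that, for fixed $\bm p$, $\Lambda(\bm x,\bm p)$ is weakly increasing in $x_i$ for each $i\in\mathcal N$. Suppose the designer can choose $(\bm\alpha,\bm\beta,k)$ freely with $\bm\alpha\in\mathbb R_+^n\setminus\{(0,\dots,0)\}$, $\bm\beta\in\mathbb R_+^n$, $k\in\{1,\dots,n\}$ to maximize the value of $\Lambda$ at the resulting SSPE outcome. Then the optimum is achieved with the dictatorial voting rule $k=1$ and zero headstarts $\bm\beta=\bm 0$. That is, for every $(\bm\alpha,\bm\beta,k)$ and every SSPE outcome $(\bm x,\bm p)$ of the game under $(\bm\alpha,\bm\beta,k)$, there exists $\hat{\bm\alpha}\in\mathbb R_+^n\setminus\{(0,\dots,0)\}$ such that the game under $(\hat{\bm\alpha},\bm 0,1)$ has an SSPE outcome $(\hat{\bm x},\hat{\bm p})$ with $\Lambda(\hat{\bm x},\hat{\bm p})\ge\Lambda(\bm x,\bm p)$.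
   Context: **The game under $(\bm\alpha,\bm\beta,k)$.** Agents $\mathcal N=\{1,\dots,n\}$ decide how to divide one dollar. In each period $t=0,1,2,\dots$ (as long as no agreement has been reached): 1. All agents simultaneously choose efforts $x_{i,t}\ge 0$ at cost $c_i(x_{i,t})$. 2. Given the effort profile $\bm x_t=(x_{1,t},\dots,x_{n,t})$, agent $i$ is recognized as proposer with probability $p_i(\bm x_t)=\tilde f_i(x_{i,t})/\sum_{j\in\mathcal N}\tilde f_j(x_{j,t})$ if $\sum_{j}\tilde f_j(x_{j,t})>0$, and $p_i(\bm x_t)=1/n$ otherwise, where $\tilde f_i=\alpha_i f_i+\beta_i$ with multiplicative bias $\alpha_i\ge 0$ and additive headstart $\beta_i\ge 0$. 3. The proposer proposes a division $\bm s_t=(s_{1,t},\dots,s_{n,t})$ with $0\le s_{i,t}\le 1$ and $\sum_i s_{i,t}=1$ (possibly chosen at random). 4. Agents simultaneously vote for or against it. The proposal is approved if at least $k$ agents (including the proposer) accept it; then the dollar is divided according to it and the game ends. Otherwise the game moves to period $t+1$. **Payoffs.** Agents are risk neutral; agent $i$ has discount factor $\delta_i\in(0,1)$. If a proposal is approved in period $\tau$, agent $i$'s payoff is $\delta_i^{\tau}s_{i,\tau}-\sum_{t=0}^{\tau}\delta_i^t c_i(x_{i,t})$; if no agreement is ever reached, it is $-\sum_{t=0}^{\infty}\delta_i^t c_i(x_{i,t})$. **Solution concept.** A strategy profile is stationary if, for each period $t$, period-$t$ actions are independent of the history of previous periods: the effort, the (possibly random) proposal made if recognized, and the voting rule as a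 function of the current proposal are the same in all periods. Effort choices are deterministic. A stationary subgame perfect equilibrium (SSPE) is a stationary strategy profile that is a subgame perfect equilibrium, with stage-undominated voting: agents vote as if pivotal, so that a non-proposer accepts a proposal if his share is at least $\delta_i v_i$ and rejects it otherwise, where $v_i$ is his equilibrium expected payoff at the beginning of a period. In equilibrium a proposer $i$ buys the votes of a cheapest coalition of $k-1$ other agents, offering each included agent $j$ the share $\delta_j v_j$, and agreement is reached without delay. **SSPE outcome.** The SSPE outcome is the pair $(\bm x,\bm p)$, where $\bm x=(x_1,\dots,x_n)$ is the profile of equilibrium (per-period) efforts and $\bm p=(p_1(\bm x),\dots,p_n(\bm x))$ the resulting profile of recognition probabilities.
   Formalization: Proved under two added assumptions, without which the claim is false: each f_i and c_i is continuous on [0,∞) (in particular at 0), and in the given SSPE outcome no agent is recognized with certainty (p_i < 1 for all i). *)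

theory Defs
  imports "HOL-Probability.Probability"
begin

text \<open>
  Agents are the elements of a finite type \<open>'n\<close>; a vector of reals indexed by agents (efforts,
  divisions, recognition probabilities, biases and so on) is a function \<open>'n \<Rightarrow> real\<close>.
\<close>

record ('n::finite) game =
  discount :: "'n \<Rightarrow> real"
  impact :: "'n \<Rightarrow> real \<Rightarrow> real"
  cost :: "'n \<Rightarrow> real \<Rightarrow> real"
  bias :: "'n \<Rightarrow> real"
  headstart :: "'n \<Rightarrow> real"
  quota :: nat

definition prob_simplex :: "('n::finite \<Rightarrow> real) set" where
  "prob_simplex = {s. (\<forall>i. 0 \<le> s i) \<and> (\<Sum>i\<in>UNIV. s i) = 1}"

definition score :: "('n::finite) game \<Rightarrow> ('n \<Rightarrow> real) \<Rightarrow> 'n \<Rightarrow> real" where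
  "score G x i = bias G i * impact G i (x i) + headstart G i"

definition recognition :: "('n::finite) game \<Rightarrow> ('n \<Rightarrow> real) \<Rightarrow> 'n \<Rightarrow> real" where
  "recognition G x i =
     (if (\<Sum>j\<in>UNIV. score G x j) > 0 then score G x i / (\<Sum>j\<in>UNIV. score G x j)
      else 1 / real CARD('n))"

text \<open>
  A past period is recorded as (efforts, proposer, proposal, set of agents in favour); a history
  lists the past periods, oldest first. The proposer always counts as being in favour.
\<close>

type_synonym 'n history = "(('n \<Rightarrow> real) \<times> 'n \<times> ('n \<Rightarrow> real) \<times> 'n set) list"

text \<open>
  Strategies may condition on everything that has been observed. Random proposals are lotteries of
  type \<open>pmf\<close>, so no measurability conditions are needed on strategies.
\<close>

record ('n::finite) strategy =
  effort :: "'n history \<Rightarrow> real"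
  propose :: "'n history \<Rightarrow> ('n \<Rightarrow> real) \<Rightarrow> ('n \<Rightarrow> real) pmf"
  vote :: "'n history \<Rightarrow> ('n \<Rightarrow> real) \<Rightarrow> 'n \<Rightarrow> ('n \<Rightarrow> real) \<Rightarrow> bool"

definition feasible :: "('n::finite) strategy \<Rightarrow> bool" where
  "feasible \<tau> \<longleftrightarrow>
     (\<forall>h. 0 \<le> effort \<tau> h) \<and> (\<forall>h x. set_pmf (propose \<tau> h x) \<subseteq> prob_simplex)"

definition supporters ::
  "('n::finite \<Rightarrow> 'n strategy) \<Rightarrow> 'n history \<Rightarrow> ('n \<Rightarrow> real) \<Rightarrow> 'n \<Rightarrow> ('n \<Rightarrow> real) \<Rightarrow> 'n set" where
  "supporters \<sigma> h x j s = insert j {i. i \<noteq> j \<and> vote (\<sigma> i) h x j s}"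

definition approved :: "('n::finite) game \<Rightarrow> 'n set \<Rightarrow> bool" where
  "approved G A \<longleftrightarrow> quota G \<le> card A"

text \<open>
  Histories after which the game is still going on.
\<close>

definition ongoing :: "('n::finite) game \<Rightarrow> 'n history \<Rightarrow> bool" where
  "ongoing G h \<longleftrightarrow>
     (\<forall>(x, j, s, A) \<in> set h. (\<forall>i. 0 \<le> x i) \<and> s \<in> prob_simplex \<and> j \<in> A \<and> \<not> approved G A)"

text \<open>
  Expectation at the three kinds of node of a period (votes about to be cast on the proposal \<open>s\<close>;
  \<open>j\<close> about to propose; efforts \<open>x\<close> sunk, proposer about to be drawn) of the quantity that equals
  \<open>g s\<close> if the division \<open>s\<close> is approved in this period and \<open>w h'\<close> if the next period is reached
  with history \<open>h'\<close>.
\<close>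

definition at_vote ::
  "('n::finite) game \<Rightarrow> ('n \<Rightarrow> 'n strategy) \<Rightarrow> (('n \<Rightarrow> real) \<Rightarrow> ennreal) \<Rightarrow> ('n history \<Rightarrow> ennreal) \<Rightarrow>
   'n history \<Rightarrow> ('n \<Rightarrow> real) \<Rightarrow> 'n \<Rightarrow> ('n \<Rightarrow> real) \<Rightarrow> ennreal" where
  "at_vote G \<sigma> g w h x j s =
     (let A = supporters \<sigma> h x j s in if approved G A then g s else w (h @ [(x, j, s, A)]))"

definition at_proposal ::
  "('n::finite) game \<Rightarrow> ('n \<Rightarrow> 'n strategy) \<Rightarrow> (('n \<Rightarrow> real) \<Rightarrow> ennreal) \<Rightarrow> ('n history \<Rightarrow> ennreal) \<Rightarrow>
   'n history \<Rightarrow> ('n \<Rightarrow> real) \<Rightarrow> 'n \<Rightarrow> ennreal" where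
  "at_proposal G \<sigma> g w h x j =
     (\<integral>\<^sup>+ s. at_vote G \<sigma> g w h x j s \<partial>measure_pmf (propose (\<sigma> j) h x))"

definition at_recognition ::
  "('n::finite) game \<Rightarrow> ('n \<Rightarrow> 'n strategy) \<Rightarrow> (('n \<Rightarrow> real) \<Rightarrow> ennreal) \<Rightarrow> ('n history \<Rightarrow> ennreal) \<Rightarrow>
   'n history \<Rightarrow> ('n \<Rightarrow> real) \<Rightarrow> ennreal" where
  "at_recognition G \<sigma> g w h x =
     (\<Sum>j\<in>UNIV. ennreal (recognition G x j) * at_proposal G \<sigma> g w h x j)"

definition efforts :: "('n::finite \<Rightarrow> 'n strategy) \<Rightarrow> 'n history \<Rightarrow> 'n \<Rightarrow> real" where
  "efforts \<sigma> h = (\<lambda>i. effort (\<sigma> i) h)"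

text \<open>
  Expected discounted share and expected discounted effort cost of agent \<open>i\<close> from the first \<open>T\<close>
  periods following the history \<open>h\<close>, in units of the period that starts after \<open>h\<close>. They are kept
  apart as extended nonnegative reals because a strategy may have infinite expected cost.
\<close>

primrec share_upto ::
  "('n::finite) game \<Rightarrow> ('n \<Rightarrow> 'n strategy) \<Rightarrow> 'n \<Rightarrow> nat \<Rightarrow> 'n history \<Rightarrow> ennreal" where
  "share_upto G \<sigma> i 0 = (\<lambda>h. 0)"
| "share_upto G \<sigma> i (Suc T) = (\<lambda>h.
     at_recognition G \<sigma> (\<lambda>s. ennreal (s i))
       (\<lambda>h'. ennreal (discount G i) * share_upto G \<sigma> i T h') h (efforts \<sigma> h))"

primrec cost_upto ::
  "('n::finite) game \<Rightarrow> ('n \<Rightarrow> 'n strategy) \<Rightarrow> 'n \<Rightarrow> nat \<Rightarrow> 'n history \<Rightarrow> ennreal" where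
  "cost_upto G \<sigma> i 0 = (\<lambda>h. 0)"
| "cost_upto G \<sigma> i (Suc T) = (\<lambda>h.
     ennreal (cost G i (effort (\<sigma> i) h)) +
     at_recognition G \<sigma> (\<lambda>s. 0)
       (\<lambda>h'. ennreal (discount G i) * cost_upto G \<sigma> i T h') h (efforts \<sigma> h))"

definition total_share ::
  "('n::finite) game \<Rightarrow> ('n \<Rightarrow> 'n strategy) \<Rightarrow> 'n \<Rightarrow> 'n history \<Rightarrow> ennreal" where
  "total_share G \<sigma> i h = (SUP T. share_upto G \<sigma> i T h)"

definition total_cost ::
  "('n::finite) game \<Rightarrow> ('n \<Rightarrow> 'n strategy) \<Rightarrow> 'n \<Rightarrow> 'n history \<Rightarrow> ennreal" where
  "total_cost G \<sigma> i h = (SUP T. cost_upto G \<sigma> i T h)"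

text \<open>
  Expected continuation payoffs in the subgames starting at the beginning of a period, at a proposal
  and at a vote, discounted to the current period and net of efforts that are already sunk (which
  rescales and shifts payoffs within the subgame, hence does not affect best responses there).
\<close>

definition payoff :: "('n::finite) game \<Rightarrow> ('n \<Rightarrow> 'n strategy) \<Rightarrow> 'n \<Rightarrow> 'n history \<Rightarrow> ereal" where
  "payoff G \<sigma> i h = enn2ereal (total_share G \<sigma> i h) - enn2ereal (total_cost G \<sigma> i h)"

definition proposal_payoff ::
  "('n::finite) game \<Rightarrow> ('n \<Rightarrow> 'n strategy) \<Rightarrow> 'n \<Rightarrow> 'n history \<Rightarrow> ('n \<Rightarrow> real) \<Rightarrow> 'n \<Rightarrow> ereal" where
  "proposal_payoff G \<sigma> i h x j =
     enn2ereal (at_proposal G \<sigma> (\<lambda>s. ennreal (s i))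
       (\<lambda>h'. ennreal (discount G i) * total_share G \<sigma> i h') h x j) -
     enn2ereal (at_proposal G \<sigma> (\<lambda>s. 0)
       (\<lambda>h'. ennreal (discount G i) * total_cost G \<sigma> i h') h x j)"

definition vote_payoff ::
  "('n::finite) game \<Rightarrow> ('n \<Rightarrow> 'n strategy) \<Rightarrow> 'n \<Rightarrow> 'n history \<Rightarrow> ('n \<Rightarrow> real) \<Rightarrow> 'n \<Rightarrow> ('n \<Rightarrow> real) \<Rightarrow>
   ereal" where
  "vote_payoff G \<sigma> i h x j s =
     enn2ereal (at_vote G \<sigma> (\<lambda>s. ennreal (s i))
       (\<lambda>h'. ennreal (discount G i) * total_share G \<sigma> i h') h x j s) -
     enn2ereal (at_vote G \<sigma> (\<lambda>s. 0)
       (\<lambda>h'. ennreal (discount G i) * total_cost G \<sigma> i h') h x j s)"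

text \<open>
  Optimality is required at every node, also after efforts off the equilibrium path and after draws
  of a proposer that have probability zero. Deviations are arbitrary history-dependent strategies.
\<close>

definition subgame_perfect :: "('n::finite) game \<Rightarrow> ('n \<Rightarrow> 'n strategy) \<Rightarrow> bool" where
  "subgame_perfect G \<sigma> \<longleftrightarrow>
     (\<forall>i. feasible (\<sigma> i)) \<and>
     (\<forall>i \<tau> h. feasible \<tau> \<longrightarrow> ongoing G h \<longrightarrow>
        payoff G (\<sigma>(i := \<tau>)) i h \<le> payoff G \<sigma> i h \<and>
        (\<forall>x j. (\<forall>l. 0 \<le> x l) \<longrightarrow>
           proposal_payoff G (\<sigma>(i := \<tau>)) i h x j \<le> proposal_payoff G \<sigma> i h x j \<and>
           (\<forall>s\<in>prob_simplex. vote_payoff G (\<sigma>(i := \<tau>)) i h x j s \<le> vote_payoff G \<sigma> i h x j s)))"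

definition stationary :: "('n::finite \<Rightarrow> 'n strategy) \<Rightarrow> bool" where
  "stationary \<sigma> \<longleftrightarrow>
     (\<forall>i. \<exists>e q a. \<forall>h. effort (\<sigma> i) h = e \<and> (\<forall>x. propose (\<sigma> i) h x = q) \<and>
        (\<forall>x j s. vote (\<sigma> i) h x j s = a s))"

text \<open>
  For a stationary profile the payoff at the beginning of a period does not depend on the history;
  it is evaluated at the empty one.
\<close>

definition stage_undominated_voting :: "('n::finite) game \<Rightarrow> ('n \<Rightarrow> 'n strategy) \<Rightarrow> bool" where
  "stage_undominated_voting G \<sigma> \<longleftrightarrow>
     (\<forall>i j h x. \<forall>s\<in>prob_simplex. i \<noteq> j \<longrightarrow>
        (vote (\<sigma> i) h x j s \<longleftrightarrow> ereal (discount G i) * payoff G \<sigma> i [] \<le> ereal (s i)))"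

definition sspe :: "('n::finite) game \<Rightarrow> ('n \<Rightarrow> 'n strategy) \<Rightarrow> bool" where
  "sspe G \<sigma> \<longleftrightarrow> stationary \<sigma> \<and> subgame_perfect G \<sigma> \<and> stage_undominated_voting G \<sigma>"

definition sspe_outcome :: "('n::finite) game \<Rightarrow> ('n \<Rightarrow> real) \<Rightarrow> ('n \<Rightarrow> real) \<Rightarrow> bool" where
  "sspe_outcome G x p \<longleftrightarrow> (\<exists>\<sigma>. sspe G \<sigma> \<and> x = efforts \<sigma> [] \<and> p = recognition G x)"

end

theory Submission
  imports Defs
begin

text \<open>
  At an SSPE, an agent who is recognized gets at most the whole dollar, and at least nothing when
  somebody else is recognized. Hence the first-order condition of an agent exerting effort
  \<open>x\<^sub>i > 0\<close> gives \<open>c\<^sub>i'(x\<^sub>i) f\<^sub>i(x\<^sub>i) \<le> p\<^sub>i (1 - p\<^sub>i) f\<^sub>i'(x\<^sub>i)\<close>, where a headstart can only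
  reduce the marginal effect of effort on recognition. With quota 1 the proposer keeps the dollar, and
  without headstarts this condition holds with equality and determines the effort from \<open>p\<^sub>i\<close>. Since
  \<open>c\<^sub>i' f\<^sub>i / f\<^sub>i'\<close> is strictly increasing, the effort that solves the equality is at least \<open>x\<^sub>i\<close>, and
  biases proportional to \<open>p\<^sub>i / f\<^sub>i\<close> at these efforts reproduce the same recognition probabilities.
\<close>

section \<open>Recognition probabilities\<close>

lemma recognition_nonneg:
  assumes "\<And>j. 0 \<le> score G x j"
  shows "0 \<le> recognition G x i"
  using assms by (auto simp: recognition_def)

lemma sum_recognition:
  fixes G :: "('n::finite) game"
  shows "(\<Sum>i\<in>UNIV. recognition G x i) = 1"
proof (cases "0 < (\<Sum>j\<in>UNIV. score G x j)")
  case True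
  then show ?thesis
    by (simp add: recognition_def flip: sum_divide_distrib)
qed (simp add: recognition_def)

lemma sum_ennreal_recognition:
  assumes "\<And>j. 0 \<le> score G x j"
  shows "(\<Sum>i\<in>UNIV. ennreal (recognition G x i)) = 1"
  using assms by (simp add: sum_ennreal recognition_nonneg sum_recognition)

lemma recognition_in_simplex:
  assumes "\<And>j. 0 \<le> score G x j"
  shows "recognition G x \<in> prob_simplex"
  using assms by (simp add: prob_simplex_def recognition_nonneg sum_recognition)

lemma simplex_le_1:
  fixes s :: "'n::finite \<Rightarrow> real"
  assumes "s \<in> prob_simplex"
  shows "s i \<le> 1"
proof -
  have "s i \<le> (\<Sum>j\<in>UNIV. s j)"
    using assms by (intro member_le_sum) (auto simp: prob_simplex_def)
  then show ?thesis
    using assms by (simp add: prob_simplex_def)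
qed

section \<open>Recursive form of expected shares and costs\<close>

lemma at_recognition_mono:
  assumes "\<And>h'. w h' \<le> w' h'"
  shows "at_recognition G \<sigma> g w h x \<le> at_recognition G \<sigma> g w' h x"
  unfolding at_recognition_def at_proposal_def at_vote_def Let_def
  using assms by (intro sum_mono mult_left_mono nn_integral_mono) auto

text \<open>Monotone convergence over the proposal lottery: whether a proposal passes does not
  depend on \<open>T\<close>, so the supremum only acts on the continuation branch.\<close>

lemma at_proposal_SUP:
  assumes "\<And>h'. incseq (\<lambda>T. w T h')"
  shows "at_proposal G \<sigma> g (\<lambda>h'. SUP T. w T h') h x j = (SUP T. at_proposal G \<sigma> g (w T) h x j)"
proof -
  have "(SUP T. at_proposal G \<sigma> g (w T) h x j) =
      (\<integral>\<^sup>+ s. (SUP T. at_vote G \<sigma> g (w T) h x j s) \<partial>measure_pmf (propose (\<sigma> j) h x))"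
    unfolding at_proposal_def using assms
    by (intro nn_integral_monotone_convergence_SUP[symmetric])
      (auto simp: incseq_def le_fun_def at_vote_def Let_def)
  also have "\<dots> = at_proposal G \<sigma> g (\<lambda>h'. SUP T. w T h') h x j"
    unfolding at_proposal_def by (intro nn_integral_cong) (auto simp: at_vote_def Let_def)
  finally show ?thesis ..
qed

lemma at_recognition_SUP:
  assumes "\<And>h'. incseq (\<lambda>T. w T h')"
  shows "at_recognition G \<sigma> g (\<lambda>h'. SUP T. w T h') h x = (SUP T. at_recognition G \<sigma> g (w T) h x)"
proof -
  have "incseq (\<lambda>T. ennreal (recognition G x j) * at_proposal G \<sigma> g (w T) h x j)" for j
    unfolding incseq_def at_proposal_def at_vote_def Let_def using assms
    by (intro allI impI mult_left_mono nn_integral_mono) (auto simp: incseq_def)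
  then show ?thesis
    unfolding at_recognition_def
    by (simp add: at_proposal_SUP[OF assms] SUP_mult_left_ennreal ennreal_SUP_sum)
qed

lemma SUP_Suc_incseq:
  fixes u :: "nat \<Rightarrow> 'a::complete_lattice"
  assumes "incseq u"
  shows "(SUP T. u T) = (SUP T. u (Suc T))"
  using assms by (intro antisym SUP_least) (auto intro: SUP_upper2 simp: incseq_Suc_iff)

lemma incseq_share_upto: "incseq (\<lambda>T. share_upto G \<sigma> i T h)"
proof (rule incseq_SucI)
  show "share_upto G \<sigma> i T h \<le> share_upto G \<sigma> i (Suc T) h" for T
    by (induction T arbitrary: h) (auto intro!: at_recognition_mono mult_left_mono)
qed

lemma incseq_cost_upto: "incseq (\<lambda>T. cost_upto G \<sigma> i T h)"
proof (rule incseq_SucI)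
  show "cost_upto G \<sigma> i T h \<le> cost_upto G \<sigma> i (Suc T) h" for T
    by (induction T arbitrary: h) (auto intro!: at_recognition_mono mult_left_mono add_left_mono)
qed

text \<open>The finite-horizon recursion passes to the limit by monotone convergence, which gives
  the Bellman equation for infinite-horizon shares.\<close>

lemma total_share_unfold:
  "total_share G \<sigma> i h = at_recognition G \<sigma> (\<lambda>s. ennreal (s i))
     (\<lambda>h'. ennreal (discount G i) * total_share G \<sigma> i h') h (efforts \<sigma> h)"
proof -
  have "incseq (\<lambda>T. ennreal (discount G i) * share_upto G \<sigma> i T h')" for h'
    using incseq_share_upto[of G \<sigma> i h'] by (auto simp: incseq_def intro!: mult_left_mono)
  note sup = at_recognition_SUP[OF this]
  show ?thesis
    unfolding total_share_def SUP_Suc_incseq[OF incseq_share_upto, of G \<sigma> i h]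
    by (simp add: SUP_mult_left_ennreal sup)
qed

lemma total_cost_unfold:
  "total_cost G \<sigma> i h = ennreal (cost G i (effort (\<sigma> i) h)) + at_recognition G \<sigma> (\<lambda>s. 0)
     (\<lambda>h'. ennreal (discount G i) * total_cost G \<sigma> i h') h (efforts \<sigma> h)"
proof -
  have "incseq (\<lambda>T. ennreal (discount G i) * cost_upto G \<sigma> i T h')" for h'
    using incseq_cost_upto[of G \<sigma> i h'] by (auto simp: incseq_def intro!: mult_left_mono)
  note sup = at_recognition_SUP[OF this]
  show ?thesis
    unfolding total_cost_def SUP_Suc_incseq[OF incseq_cost_upto, of G \<sigma> i h]
    by (simp add: SUP_mult_left_ennreal sup ennreal_SUP_add_right)
qed

section \<open>One-shot effort deviations\<close>

text \<open>The deviation is tied to the empty history, which never recurs as histories only grow.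
  Every continuation value after it is therefore the one under \<open>\<sigma>\<close>.\<close>

definition one_shot ::
  "('n::finite \<Rightarrow> 'n strategy) \<Rightarrow> 'n \<Rightarrow> real \<Rightarrow> 'n strategy" where
  "one_shot \<sigma> i y = (\<sigma> i)\<lparr>effort := (\<lambda>h. if h = [] then y else effort (\<sigma> i) h)\<rparr>"

lemma feasible_one_shot: "feasible (\<sigma> i) \<Longrightarrow> 0 \<le> y \<Longrightarrow> feasible (one_shot \<sigma> i y)"
  by (auto simp: feasible_def one_shot_def)

lemma efforts_one_shot:
  "efforts (\<sigma>(i := one_shot \<sigma> i y)) h = (if h = [] then (efforts \<sigma> [])(i := y) else efforts \<sigma> h)"
  by (auto simp: efforts_def one_shot_def)

text \<open>The next history has the form \<open>h @ [z]\<close> and is never empty, so agreement of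
  \<open>w\<close> and \<open>w'\<close> on nonempty histories is enough.\<close>

lemma at_recognition_one_shot:
  assumes "\<And>h'. h' \<noteq> [] \<Longrightarrow> w h' = w' h'"
  shows "at_recognition G (\<sigma>(i := one_shot \<sigma> i y)) g w h x = at_recognition G \<sigma> g w' h x"
proof -
  have "supporters (\<sigma>(i := one_shot \<sigma> i y)) h x j s = supporters \<sigma> h x j s" for j s
    by (auto simp: supporters_def one_shot_def)
  moreover have "propose ((\<sigma>(i := one_shot \<sigma> i y)) j) h x = propose (\<sigma> j) h x" for j
    by (simp add: one_shot_def)
  moreover have w: "w (h @ [z]) = w' (h @ [z])" for z
    by (rule assms) simp
  ultimately show ?thesis
    unfolding at_recognition_def at_proposal_def at_vote_def Let_def
    by (simp only: w)
qed

lemma share_upto_one_shot: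
  "h \<noteq> [] \<Longrightarrow> share_upto G (\<sigma>(i := one_shot \<sigma> i y)) l T h = share_upto G \<sigma> l T h"
  by (induction T arbitrary: h) (auto simp: efforts_one_shot intro!: at_recognition_one_shot)

lemma cost_upto_one_shot:
  "h \<noteq> [] \<Longrightarrow> cost_upto G (\<sigma>(i := one_shot \<sigma> i y)) l T h = cost_upto G \<sigma> l T h"
proof (induction T arbitrary: h)
  case (Suc T)
  have eff: "effort ((\<sigma>(i := one_shot \<sigma> i y)) l) h = effort (\<sigma> l) h"
    using Suc.prems by (simp add: one_shot_def)
  have "at_recognition G (\<sigma>(i := one_shot \<sigma> i y)) (\<lambda>s. 0)
      (\<lambda>h'. ennreal (discount G l) * cost_upto G (\<sigma>(i := one_shot \<sigma> i y)) l T h') h x =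
    at_recognition G \<sigma> (\<lambda>s. 0) (\<lambda>h'. ennreal (discount G l) * cost_upto G \<sigma> l T h') h x" for x
    by (intro at_recognition_one_shot arg_cong2[where f = "(*)"] refl Suc.IH)
  then show ?case
    using Suc.prems by (simp only: cost_upto.simps eff efforts_one_shot if_False)
qed simp

lemma total_share_one_shot:
  "total_share G (\<sigma>(i := one_shot \<sigma> i y)) i [] = at_recognition G \<sigma> (\<lambda>s. ennreal (s i))
     (\<lambda>h'. ennreal (discount G i) * total_share G \<sigma> i h') [] ((efforts \<sigma> [])(i := y))"
  unfolding total_share_unfold[of G "\<sigma>(i := one_shot \<sigma> i y)" i "[]"] efforts_one_shot
  by (simp, rule at_recognition_one_shot) (simp add: total_share_def share_upto_one_shot)

lemma total_cost_one_shot: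
  "total_cost G (\<sigma>(i := one_shot \<sigma> i y)) i [] = ennreal (cost G i y) + at_recognition G \<sigma> (\<lambda>s. 0)
     (\<lambda>h'. ennreal (discount G i) * total_cost G \<sigma> i h') [] ((efforts \<sigma> [])(i := y))"
proof -
  have "at_recognition G (\<sigma>(i := one_shot \<sigma> i y)) (\<lambda>s. 0)
      (\<lambda>h'. ennreal (discount G i) * total_cost G (\<sigma>(i := one_shot \<sigma> i y)) i h') [] x =
    at_recognition G \<sigma> (\<lambda>s. 0) (\<lambda>h'. ennreal (discount G i) * total_cost G \<sigma> i h') [] x" for x
    by (rule at_recognition_one_shot) (simp add: total_cost_def cost_upto_one_shot)
  moreover have "effort ((\<sigma>(i := one_shot \<sigma> i y)) i) [] = y"
    by (simp add: one_shot_def)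
  ultimately show ?thesis
    unfolding total_cost_unfold[of G "\<sigma>(i := one_shot \<sigma> i y)" i "[]"] efforts_one_shot by simp
qed

section \<open>Stationary profiles\<close>

lemma stationary_effort: "stationary \<sigma> \<Longrightarrow> effort (\<sigma> i) h = effort (\<sigma> i) []"
  unfolding stationary_def by metis

lemma stationary_efforts: "stationary \<sigma> \<Longrightarrow> efforts \<sigma> h = efforts \<sigma> []"
  unfolding efforts_def using stationary_effort by metis

lemma stationary_propose: "stationary \<sigma> \<Longrightarrow> propose (\<sigma> i) h x = propose (\<sigma> i) [] x0"
  unfolding stationary_def by metis

lemma stationary_supporters:
  assumes "stationary \<sigma>"
  shows "supporters \<sigma> h x j s = supporters \<sigma> [] x0 j s"
proof -
  have "vote (\<sigma> i) h x j s = vote (\<sigma> i) [] x0 j s" for i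
    using assms unfolding stationary_def by metis
  then show ?thesis
    by (simp add: supporters_def)
qed

text \<open>With a constant continuation value \<open>K\<close>, sunk efforts influence neither
  proposals nor votes. An effort deviation thus acts only through recognition probabilities, and the
  rewards they weight stay fixed.\<close>

lemma stationary_at_proposal:
  assumes "stationary \<sigma>"
  shows "at_proposal G \<sigma> g (\<lambda>_. K) h x j = at_proposal G \<sigma> g (\<lambda>_. K) [] x0 j"
  unfolding at_proposal_def at_vote_def Let_def
    stationary_propose[OF assms, of j h x x0] stationary_supporters[OF assms, of h x _ _ x0] ..

lemma stationary_at_recognition:
  assumes "stationary \<sigma>"
  shows "at_recognition G \<sigma> g (\<lambda>_. K) h x = at_recognition G \<sigma> g (\<lambda>_. K) [] x"
  unfolding at_recognition_def using stationary_at_proposal[OF assms] by metis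

lemma stationary_share_upto:
  assumes "stationary \<sigma>"
  shows "share_upto G \<sigma> i T h = share_upto G \<sigma> i T []"
proof (induction T arbitrary: h)
  case (Suc T)
  \<comment> \<open>The induction hypothesis holds at all histories, so the continuation value is a
    constant function.\<close>
  then obtain K where K: "share_upto G \<sigma> i T = (\<lambda>_. K)"
    by blast
  show ?case
    unfolding share_upto.simps K stationary_efforts[OF assms, of h]
      stationary_at_recognition[OF assms, of _ _ _ h] ..
qed simp

lemma stationary_cost_upto:
  assumes "stationary \<sigma>"
  shows "cost_upto G \<sigma> i T h = cost_upto G \<sigma> i T []"
proof (induction T arbitrary: h)
  case (Suc T)
  then obtain K where K: "cost_upto G \<sigma> i T = (\<lambda>_. K)"
    by blast
  show ?case
    unfolding cost_upto.simps K stationary_efforts[OF assms, of h]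
      stationary_effort[OF assms, of i h]
      stationary_at_recognition[OF assms, of _ _ _ h] ..
qed simp

section \<open>Bounds on expected shares and costs\<close>

lemma at_recognition_le:
  assumes "\<And>j. feasible (\<sigma> j)" and "\<And>j. 0 \<le> score G x j"
    and "\<And>s. s \<in> prob_simplex \<Longrightarrow> g s \<le> M" and "\<And>h'. w h' \<le> M"
  shows "at_recognition G \<sigma> g w h x \<le> M"
proof -
  have "at_proposal G \<sigma> g w h x j \<le> M" for j
  proof -
    have "at_proposal G \<sigma> g w h x j \<le> (\<integral>\<^sup>+ s. M \<partial>measure_pmf (propose (\<sigma> j) h x))"
      unfolding at_proposal_def using assms(1)[of j] assms(3,4)
      by (intro nn_integral_mono_AE AE_pmfI) (auto simp: at_vote_def Let_def feasible_def subset_iff)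
    then show ?thesis
      by simp
  qed
  then have "at_recognition G \<sigma> g w h x \<le> (\<Sum>j\<in>UNIV. ennreal (recognition G x j) * M)"
    unfolding at_recognition_def by (intro sum_mono mult_left_mono) auto
  also have "\<dots> = M"
    using sum_ennreal_recognition[OF assms(2)] by (simp flip: sum_distrib_right)
  finally show ?thesis .
qed

lemma total_share_le_1:
  assumes "\<And>j. feasible (\<sigma> j)" and "\<And>h j. 0 \<le> score G (efforts \<sigma> h) j"
    and "discount G i \<le> 1"
  shows "total_share G \<sigma> i h \<le> 1"
proof -
  have "share_upto G \<sigma> i T h \<le> 1" for T
  proof (induction T arbitrary: h)
    case (Suc T)
    have "ennreal (discount G i) * share_upto G \<sigma> i T h' \<le> 1 * 1" for h'
      using Suc assms(3) by (intro mult_mono) auto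
    then show ?case
      using assms(1,2) simplex_le_1 by (auto intro!: at_recognition_le)
  qed simp
  then show ?thesis
    unfolding total_share_def by (rule SUP_least)
qed

text \<open>The bound is the geometric series of paying the same cost forever. It is the fixed point
  of adding the current cost to the discounted bound, so induction on the horizon preserves it.
  Finiteness makes the equilibrium payoff a real number.\<close>

lemma stationary_total_cost_le:
  assumes "stationary \<sigma>" and "\<And>j. feasible (\<sigma> j)" and "\<And>h j. 0 \<le> score G (efforts \<sigma> h) j"
    and "0 \<le> discount G i" "discount G i < 1" and "0 \<le> cost G i (effort (\<sigma> i) [])"
  shows "total_cost G \<sigma> i h \<le> ennreal (cost G i (effort (\<sigma> i) []) / (1 - discount G i))"
    (is "_ \<le> ennreal ?M")
proof -
  have M: "0 \<le> ?M" "cost G i (effort (\<sigma> i) []) + discount G i * ?M = ?M"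
    using assms(5,6) by (auto simp: field_simps)
  have "cost_upto G \<sigma> i T h \<le> ennreal ?M" for T
  proof (induction T arbitrary: h)
    case (Suc T)
    have "at_recognition G \<sigma> (\<lambda>s. 0) (\<lambda>h'. ennreal (discount G i) * cost_upto G \<sigma> i T h') h
        (efforts \<sigma> h) \<le> ennreal (discount G i * ?M)"
      using assms(2-4) Suc M(1)
      by (intro at_recognition_le) (auto simp: ennreal_mult simp del: times_divide_eq_right
        intro!: mult_left_mono)
    then have "cost_upto G \<sigma> i (Suc T) h \<le>
        ennreal (cost G i (effort (\<sigma> i) [])) + ennreal (discount G i * ?M)"
      by (simp add: stationary_effort[OF assms(1), of i h] add_left_mono)
    also have "\<dots> = ennreal ?M"
      using assms(4,6) M by (subst ennreal_plus[symmetric]) (auto simp del: times_divide_eq_right)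
    finally show ?case .
  qed simp
  then show ?thesis
    unfolding total_cost_def by (rule SUP_least)
qed

text \<open>
  Only one-shot deviations in effort at the initial history are considered. The reward \<open>U j\<close> is the agent's expected payoff once \<open>j\<close> has
  been recognized; it is nonnegative because the agent may also exert no effort.
\<close>

lemma sspe_effort_optimal:
  fixes G :: "('n::finite) game"
  assumes \<sigma>: "sspe G \<sigma>"
    and \<delta>: "0 < discount G i" "discount G i < 1"
    and cost: "\<And>y. 0 \<le> y \<Longrightarrow> 0 \<le> cost G i y" "cost G i 0 = 0"
    and score: "\<And>x j. (\<And>l. 0 \<le> x l) \<Longrightarrow> 0 \<le> score G x j"
  defines "x \<equiv> efforts \<sigma> []"
  obtains U where "\<And>j. 0 \<le> U j" "\<And>j. U j \<le> 1"
    and "\<And>y. 0 \<le> y \<Longrightarrow> (\<Sum>j\<in>UNIV. recognition G (x(i := y)) j * U j) - cost G i y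
      \<le> (\<Sum>j\<in>UNIV. recognition G x j * U j) - cost G i (x i)"
proof -
  have stat: "stationary \<sigma>" and feas: "\<And>j. feasible (\<sigma> j)"
    and opt: "\<And>\<tau>. feasible \<tau> \<Longrightarrow> payoff G (\<sigma>(i := \<tau>)) i [] \<le> payoff G \<sigma> i []"
    using \<sigma> by (auto simp: sspe_def subgame_perfect_def ongoing_def)
  have eff: "0 \<le> efforts \<sigma> h j" for h j
    using feas by (auto simp: efforts_def feasible_def)
  have x: "0 \<le> x j" for j
    by (simp add: x_def eff)
  have sc: "0 \<le> score G (efforts \<sigma> h) j" for h j
    using eff by (rule score)
  have sc': "0 \<le> score G (x(i := y)) j" if "0 \<le> y" for y j
    using x that by (intro score) simp
  define S where "S = total_share G \<sigma> i []"
  define C where "C = total_cost G \<sigma> i []"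
  have S1: "S \<le> 1"
    unfolding S_def using feas sc \<delta> by (intro total_share_le_1) auto
  have C1: "C < \<top>"
    using stationary_total_cost_le[OF stat feas sc, of i "[]"] \<delta> cost(1) eff[of "[]" i]
    by (auto simp: C_def efforts_def intro: le_less_trans)
  have S_const: "total_share G \<sigma> i h = S" for h
    unfolding S_def total_share_def by (simp only: stationary_share_upto[OF stat, of _ _ _ h])
  have C_const: "total_cost G \<sigma> i h = C" for h
    unfolding C_def total_cost_def by (simp only: stationary_cost_upto[OF stat, of _ _ _ h])
  define s where "s = enn2real S"
  define c where "c = enn2real C"
  have sS: "S = ennreal s" and s: "0 \<le> s" "s \<le> 1"
    using S1 by (auto simp: s_def enn2real_leI ennreal_enn2real_if top_unique)
  have cC: "C = ennreal c" and c: "0 \<le> c"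
    using C1 by (auto simp: c_def)
  \<comment> \<open>Delay is not excluded here: \<open>m j\<close> will be the probability that the
    proposal of \<open>j\<close> fails, in which case the discounted \<open>S\<close> and
    \<open>C\<close> are obtained.\<close>
  define N where "N j = {a. \<not> approved G (supporters \<sigma> [] x j a)}" for j
  define Q where "Q j = propose (\<sigma> j) [] x" for j
  define m where "m j = measure_pmf.prob (Q j) (N j)" for j
  have m: "0 \<le> m j" "m j \<le> 1" for j
    by (auto simp: m_def)
  define P where
    "P j = at_proposal G \<sigma> (\<lambda>a. ennreal (a i)) (\<lambda>_. ennreal (discount G i) * S) [] x j" for j
  define D where
    "D j = at_proposal G \<sigma> (\<lambda>_. 0) (\<lambda>_. ennreal (discount G i) * C) [] x j" for j
  have nn_N: "(\<integral>\<^sup>+ a. ennreal K * indicator (N j) a \<partial>measure_pmf (Q j)) = ennreal (K * m j)"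
    if "0 \<le> K" for K j
    using that m(1) by (simp add: nn_integral_cmult measure_pmf.emeasure_eq_measure m_def ennreal_mult)
  have D_eq: "D j = ennreal (discount G i * c * m j)" for j
  proof -
    have "D j = (\<integral>\<^sup>+ a. ennreal (discount G i * c) * indicator (N j) a \<partial>measure_pmf (Q j))"
      unfolding D_def at_proposal_def Q_def cC using \<delta> c
      by (intro nn_integral_cong) (auto simp: at_vote_def N_def Let_def ennreal_mult indicator_def)
    then show ?thesis
      using nn_N[of "discount G i * c" j] \<delta> c by simp
  qed
  have P_ge: "ennreal (discount G i * s * m j) \<le> P j" for j
  proof -
    have "(\<integral>\<^sup>+ a. ennreal (discount G i * s) * indicator (N j) a \<partial>measure_pmf (Q j)) \<le> P j"
      unfolding P_def at_proposal_def Q_def sS using \<delta> s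
      by (intro nn_integral_mono) (auto simp: at_vote_def N_def Let_def ennreal_mult indicator_def)
    then show ?thesis
      using nn_N[of "discount G i * s" j] \<delta> s by simp
  qed
  have P_le: "P j \<le> 1" for j
  proof -
    have "ennreal (discount G i) * S \<le> 1 * 1"
      using \<delta> S1 by (intro mult_mono) auto
    moreover have "a i \<le> 1" if "a \<in> set_pmf (Q j)" for a
      using that feas[of j] by (intro simplex_le_1) (auto simp: feasible_def Q_def)
    ultimately have "P j \<le> (\<integral>\<^sup>+ a. 1 \<partial>measure_pmf (Q j))"
      unfolding P_def at_proposal_def Q_def[symmetric]
      by (intro nn_integral_mono_AE AE_pmfI) (auto simp: at_vote_def Let_def)
    then show ?thesis
      by simp
  qed
  define q where "q j = enn2real (P j)" for j
  define d where "d j = discount G i * c * m j" for j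
  have Pq: "P j = ennreal (q j)" and q: "0 \<le> q j" "q j \<le> 1" for j
    using P_le[of j] by (auto simp: q_def enn2real_leI ennreal_enn2real_if top_unique)
  have q_ge: "discount G i * s * m j \<le> q j" for j
    using P_ge[of j] q[of j] by (simp add: Pq)
  have d: "0 \<le> d j" for j
    using \<delta> c m by (simp add: d_def)
  have rec: "at_recognition G \<sigma> (\<lambda>a. ennreal (a i)) (\<lambda>_. ennreal (discount G i) * S) [] (x(i := y)) =
      ennreal (\<Sum>j\<in>UNIV. recognition G (x(i := y)) j * q j)"
    "at_recognition G \<sigma> (\<lambda>_. 0) (\<lambda>_. ennreal (discount G i) * C) [] (x(i := y)) =
      ennreal (\<Sum>j\<in>UNIV. recognition G (x(i := y)) j * d j)" if "0 \<le> y" for y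
    using recognition_nonneg[OF sc'[OF that]] q d
    unfolding at_recognition_def stationary_at_proposal[OF stat, of _ _ _ "[]" "x(i := y)" _ x]
    by (auto simp: P_def[symmetric] D_def[symmetric] Pq D_eq d_def[symmetric] sum_ennreal
        ennreal_mult[symmetric])
  \<comment> \<open>Recognition of \<open>j\<close> is worth the expected share \<open>q j\<close>
    less the expected later costs \<open>d j\<close>; this difference becomes the reward
    \<open>U j\<close>.\<close>
  define V where "V y = (\<Sum>j\<in>UNIV. recognition G (x(i := y)) j * (q j - d j)) - cost G i y" for y
  have dev: "payoff G (\<sigma>(i := one_shot \<sigma> i y)) i [] = ereal (V y)" if "0 \<le> y" for y
  proof -
    have "0 \<le> (\<Sum>j\<in>UNIV. recognition G (x(i := y)) j * q j)"
      "0 \<le> (\<Sum>j\<in>UNIV. recognition G (x(i := y)) j * d j)"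
      using recognition_nonneg[OF sc'[OF that]] q d by (auto intro!: sum_nonneg)
    then show ?thesis
      unfolding payoff_def total_share_one_shot total_cost_one_shot S_const C_const
      using cost(1)[OF that] rec[OF that]
      by (simp add: x_def[symmetric] ennreal_plus[symmetric] V_def right_diff_distrib sum_subtractf
          del: ennreal_plus)
  qed
  have "(\<lambda>h. if h = [] then x i else effort (\<sigma> i) h) = effort (\<sigma> i)"
    by (auto simp: x_def efforts_def)
  then have "one_shot \<sigma> i (x i) = \<sigma> i"
    by (simp add: one_shot_def)
  then have eq: "payoff G \<sigma> i [] = ereal (V (x i))"
    using dev[OF x[of i]] by simp
  have V_le: "V y \<le> V (x i)" if "0 \<le> y" for y
    using opt[OF feasible_one_shot[of \<sigma> i y]] feas that dev[OF that] eq by simp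
  have V_eq: "V (x i) = s - c"
    using eq s c unfolding payoff_def S_def[symmetric] C_def[symmetric] sS cC by simp
  \<comment> \<open>If the equilibrium payoff \<open>s - c\<close> were negative, zero effort now
    followed by \<open>\<sigma>\<close> would yield at least its discounted value, which is larger.
    Once it is nonnegative, \<open>q_ge\<close> makes all rewards nonnegative.\<close>
  have "0 \<le> s - c"
  proof (rule ccontr)
    assume neg: "\<not> 0 \<le> s - c"
    have "discount G i * (s - c) \<le> q j - d j" for j
    proof -
      have "discount G i * (s - c) * 1 \<le> discount G i * (s - c) * m j"
        using neg \<delta> m by (intro mult_left_mono_neg) (auto simp: mult_nonneg_nonpos)
      then show ?thesis
        using q_ge[of j] by (simp add: d_def algebra_simps)
    qed
    then have "(\<Sum>j\<in>UNIV. recognition G (x(i := 0)) j * (discount G i * (s - c))) \<le> V 0"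
      unfolding V_def using recognition_nonneg[OF sc'[of 0]] cost(2)
      by (auto intro!: sum_mono mult_left_mono)
    then have "discount G i * (s - c) \<le> V 0"
      using sum_recognition[of G "x(i := 0)"] by (simp flip: sum_distrib_right)
    then have "discount G i * (s - c) \<le> s - c"
      using V_le[of 0] V_eq by simp
    then show False
      using neg \<delta> by (simp add: mult_le_cancel_right1)
  qed
  then have "0 \<le> discount G i * (s - c) * m j" for j
    using \<delta> m by simp
  also have "discount G i * (s - c) * m j \<le> q j - d j" for j
    using q_ge[of j] by (simp add: d_def algebra_simps)
  finally have "0 \<le> q j - d j" for j .
  moreover have "q j - d j \<le> 1" for j
    using q[of j] d[of j] by simp
  moreover have "x(i := x i) = x"
    by simp
  ultimately show ?thesis
    using V_le by (intro that[of "\<lambda>j. q j - d j"]) (auto simp: V_def)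
qed

section \<open>First-order conditions\<close>

lemma concave_below_tangent:
  fixes g g' :: "real \<Rightarrow> real"
  assumes cont: "continuous_on {0..} g"
    and deriv: "\<And>y. 0 < y \<Longrightarrow> (g has_real_derivative g' y) (at y)"
    and anti: "\<And>y z. 0 < y \<Longrightarrow> y \<le> z \<Longrightarrow> g' z \<le> g' y"
    and "0 < a" "0 \<le> y"
  shows "g y \<le> g a + g' a * (y - a)"
proof -
  have mean: "\<exists>z. u < z \<and> z < v \<and> g v - g u = g' z * (v - u)" if "0 \<le> u" "u < v" for u v
  proof -
    have "continuous_on {u..v} g"
      using cont that by (auto intro: continuous_on_subset)
    moreover have "(g has_derivative (*) (g' z)) (at z)" if "u < z" "z < v" for z
      using deriv[of z] \<open>0 \<le> u\<close> that by (simp add: has_field_derivative_def)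
    ultimately show ?thesis
      using mvt[OF that(2), of g "\<lambda>z. (*) (g' z)"] by blast
  qed
  consider "y < a" | "y = a" | "a < y"
    by linarith
  then show ?thesis
  proof cases
    case 1
    then obtain z where z: "y < z" "z < a" "g a - g y = g' z * (a - y)"
      using mean[of y a] \<open>0 \<le> y\<close> by auto
    then have "g' a * (a - y) \<le> g' z * (a - y)"
      using anti[of z a] \<open>0 \<le> y\<close> by (intro mult_right_mono) auto
    then show ?thesis
      using z(3) by (simp add: algebra_simps)
  next
    case 3
    then obtain z where z: "a < z" "z < y" "g y - g a = g' z * (y - a)"
      using mean[of a y] \<open>0 < a\<close> by auto
    then have "g' z * (y - a) \<le> g' a * (y - a)"
      using anti[of a z] \<open>0 < a\<close> by (intro mult_right_mono) auto
    then show ?thesis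
      using z(3) by simp
  qed simp
qed

text \<open>The impact and cost functions of one agent. Differentiability covers positive efforts
  only; continuity on the closed half-line links them to effort 0, as strict monotonicity and the
  tangent bounds from 0 require.\<close>

locale contestant =
  fixes f c :: "real \<Rightarrow> real"
  assumes f_zero: "f 0 = 0"
    and f_cont: "continuous_on {0..} f"
    and f_diff: "0 < y \<Longrightarrow> f differentiable at y" "0 < y \<Longrightarrow> deriv f differentiable at y"
    and deriv_f_pos: "0 < y \<Longrightarrow> 0 < deriv f y"
    and f_concave: "0 < y \<Longrightarrow> deriv (deriv f) y \<le> 0"
    and c_zero: "c 0 = 0"
    and c_cont: "continuous_on {0..} c"
    and c_diff: "0 < y \<Longrightarrow> c differentiable at y" "0 < y \<Longrightarrow> deriv c differentiable at y"
    and deriv_c_pos: "0 < y \<Longrightarrow> 0 < deriv c y"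
    and c_convex: "0 < y \<Longrightarrow> 0 \<le> deriv (deriv c) y"
begin

lemma DERIV_f: "0 < y \<Longrightarrow> (f has_real_derivative deriv f y) (at y)"
  and DERIV_c: "0 < y \<Longrightarrow> (c has_real_derivative deriv c y) (at y)"
  and DERIV_deriv_f: "0 < y \<Longrightarrow> (deriv f has_real_derivative deriv (deriv f) y) (at y)"
  and DERIV_deriv_c: "0 < y \<Longrightarrow> (deriv c has_real_derivative deriv (deriv c) y) (at y)"
  using f_diff c_diff by (simp_all add: DERIV_deriv_iff_real_differentiable)

lemma deriv_f_antimono: "0 < y \<Longrightarrow> y \<le> z \<Longrightarrow> deriv f z \<le> deriv f y"
  by (rule DERIV_nonpos_imp_nonincreasing[of y z "deriv f"])
    (meson DERIV_deriv_f f_concave less_le_trans)+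

lemma deriv_c_mono: "0 < y \<Longrightarrow> y \<le> z \<Longrightarrow> deriv c y \<le> deriv c z"
  by (rule DERIV_nonneg_imp_nondecreasing[of y z "deriv c"])
    (meson DERIV_deriv_c c_convex less_le_trans)+

lemma f_strict_mono: "0 \<le> y \<Longrightarrow> y < z \<Longrightarrow> f y < f z"
  by (rule DERIV_pos_imp_increasing_open[of y z f])
    (assumption | (rule continuous_on_subset[OF f_cont], force) |
      meson DERIV_f deriv_f_pos le_less_trans)+

lemma c_strict_mono: "0 \<le> y \<Longrightarrow> y < z \<Longrightarrow> c y < c z"
  by (rule DERIV_pos_imp_increasing_open[of y z c])
    (assumption | (rule continuous_on_subset[OF c_cont], force) |
      meson DERIV_c deriv_c_pos le_less_trans)+

lemma f_pos: "0 < y \<Longrightarrow> 0 < f y"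
  and f_nonneg: "0 \<le> y \<Longrightarrow> 0 \<le> f y"
  and c_pos: "0 < y \<Longrightarrow> 0 < c y"
  and c_nonneg: "0 \<le> y \<Longrightarrow> 0 \<le> c y"
  using f_strict_mono[of 0 y] c_strict_mono[of 0 y] f_zero c_zero by (auto simp: le_less)

lemma f_below_tangent: "0 < a \<Longrightarrow> 0 \<le> y \<Longrightarrow> f y \<le> f a + deriv f a * (y - a)"
  using concave_below_tangent[OF f_cont DERIV_f deriv_f_antimono] by blast

lemma c_above_tangent: "0 < a \<Longrightarrow> 0 \<le> y \<Longrightarrow> c a + deriv c a * (y - a) \<le> c y"
  using concave_below_tangent[of "\<lambda>y. - c y" "\<lambda>y. - deriv c y" a y] deriv_c_mono
  by (force intro: continuous_on_minus c_cont DERIV_minus DERIV_c)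

text \<open>Intermediate value theorem. Near 0 the left side is small because \<open>f\<close>
  vanishes there. For large \<open>b\<close> the tangent of \<open>f\<close> at \<open>b\<close>,
  evaluated at 0, gives \<open>b * deriv f b \<le> f b\<close>, so the left side dominates.\<close>

lemma first_order_solution:
  assumes "0 < t"
  shows "\<exists>y>0. deriv c y * f y = t * deriv f y"
proof -
  \<comment> \<open>Chosen so that \<open>deriv c 1 * e = t * deriv f 1\<close>: once
    \<open>f\<close> is below \<open>e\<close> on the left of 1, monotone derivatives give the sign
    at the lower end.\<close>
  define e where "e = t * deriv f 1 / deriv c 1"
  have c1: "0 < deriv c 1" and f1: "0 < deriv f 1"
    using deriv_c_pos deriv_f_pos by auto
  have "0 < e"
    using assms c1 f1 by (simp add: e_def)
  then obtain d where d: "0 < d" "\<And>y. 0 \<le> y \<Longrightarrow> y < d \<Longrightarrow> \<bar>f y\<bar> < e"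
    using f_cont[unfolded continuous_on_iff, rule_format, of 0 e] f_zero
    by (auto simp: dist_real_def)
  define a where "a = min (d / 2) 1"
  define b where "b = max 1 (t / deriv c 1)"
  have a: "0 < a" "a \<le> 1" "a < d" and b: "1 \<le> b" "t \<le> deriv c 1 * b"
    using d(1) c1 by (auto simp: a_def b_def field_simps max_def)
  have "deriv c a * f a \<le> deriv c 1 * e"
    using deriv_c_mono[of a 1] d(2)[of a] a f_nonneg[of a] c1 by (intro mult_mono) auto
  also have "\<dots> = t * deriv f 1"
    using c1 by (simp add: e_def)
  also have "\<dots> \<le> t * deriv f a"
    using deriv_f_antimono[of a 1] a assms by simp
  finally have low: "deriv c a * f a - t * deriv f a \<le> 0"
    by simp
  have "t * deriv f b \<le> deriv c 1 * b * deriv f b"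
    using b deriv_f_pos[of b] by (intro mult_right_mono) auto
  also have "\<dots> = deriv c 1 * (b * deriv f b)"
    by simp
  also have "\<dots> \<le> deriv c b * f b"
    using f_below_tangent[of b 0] f_zero deriv_c_mono[of 1 b] b deriv_f_pos[of b] deriv_c_pos[of b]
    by (intro mult_mono) (auto simp: algebra_simps)
  finally have high: "0 \<le> deriv c b * f b - t * deriv f b"
    by simp
  have "isCont f y" "isCont (deriv f) y" "isCont (deriv c) y" if "0 < y" for y
    using that DERIV_f DERIV_deriv_f DERIV_deriv_c DERIV_isCont by blast+
  then have "continuous_on {a..b} (\<lambda>y. deriv c y * f y - t * deriv f y)"
    using a(1) by (intro continuous_intros continuous_at_imp_continuous_on) auto
  then obtain y where "a \<le> y" "deriv c y * f y - t * deriv f y = 0"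
    using IVT'[of "\<lambda>y. deriv c y * f y - t * deriv f y", OF low high] a b by auto
  then show ?thesis
    using a(1) by (intro exI[of _ y]) auto
qed

text \<open>Beyond the crossing point \<open>y\<close>, \<open>deriv c * f\<close> has strictly
  risen while \<open>t * deriv f\<close> has not, so the inequality at \<open>x\<close> would
  fail.\<close>

lemma first_order_le:
  assumes "0 < x" "0 < y" "0 \<le> t"
    and "deriv c x * f x \<le> t * deriv f x" "deriv c y * f y = t * deriv f y"
  shows "x \<le> y"
proof (rule ccontr)
  assume "\<not> x \<le> y"
  then have "y < x"
    by simp
  have "t * deriv f x \<le> t * deriv f y"
    using deriv_f_antimono[of y x] \<open>y < x\<close> assms by (intro mult_left_mono) auto
  also have "\<dots> = deriv c y * f y"
    using assms(5) by simp
  also have "\<dots> < deriv c y * f x"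
    using f_strict_mono[of y x] deriv_c_pos[of y] \<open>y < x\<close> assms(2)
    by (intro mult_strict_left_mono) auto
  also have "\<dots> \<le> deriv c x * f x"
    using deriv_c_mono[of y x] f_pos[of x] \<open>y < x\<close> assms by (intro mult_right_mono) auto
  finally show False
    using assms(4) by simp
qed

text \<open>
  Here \<open>a\<close> and \<open>b\<close> are the agent's bias and headstart, \<open>B\<close> is the total score of the opponents, \<open>u\<close>
  the reward of being recognized, and \<open>K\<close> the score-weighted sum of the rewards when an opponent is
  recognized. Comparisons are with positive efforts only, as the total score may vanish at effort 0.
\<close>

lemma first_order_necessary:
  assumes "0 < x" "0 \<le> a" "0 \<le> b" "0 \<le> K" "0 \<le> B" "u \<le> 1"
    and S: "0 < a * f x + b + B"
    and opt: "\<And>y. 0 < y \<Longrightarrow> ((a * f y + b) * u + K) / (a * f y + b + B) - c y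
      \<le> ((a * f x + b) * u + K) / (a * f x + b + B) - c x"
  defines "p \<equiv> (a * f x + b) / (a * f x + b + B)"
  shows "deriv c x * f x \<le> p * (1 - p) * deriv f x"
proof -
  let ?S = "a * f x + b + B"
  have "((\<lambda>y. ((a * f y + b) * u + K) / (a * f y + b + B) - c y) has_real_derivative
      (a * deriv f x * u * ?S - ((a * f x + b) * u + K) * (a * deriv f x)) / (?S * ?S) - deriv c x)
      (at x)"
    using S by (auto intro!: derivative_eq_intros DERIV_f[OF assms(1)] DERIV_c[OF assms(1)])
  \<comment> \<open>The radius of the neighbourhood is \<open>x\<close> itself, so that it contains
    only positive efforts.\<close>
  from DERIV_local_max[OF this assms(1)] opt
  have "deriv c x =
      (a * deriv f x * u * ?S - ((a * f x + b) * u + K) * (a * deriv f x)) / (?S * ?S)"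
    by (auto simp: abs_if split: if_splits)
  also have "\<dots> = a * deriv f x * (u * B - K) / (?S * ?S)"
    by (simp add: algebra_simps)
  finally have "deriv c x * f x = (a * f x) * (deriv f x * (u * B - K)) / (?S * ?S)"
    by simp
  \<comment> \<open>Three sources of slack: \<open>u \<le> 1\<close>, the opponents' term
    \<open>K\<close>, and the headstart \<open>b\<close>. All of them vanish for
    \<open>u = 1\<close>, \<open>K = 0\<close>, \<open>b = 0\<close>.\<close>
  also have "\<dots> \<le> (a * f x + b) * (deriv f x * B) / (?S * ?S)"
  proof (rule divide_right_mono)
    have "u * B \<le> 1 * B"
      using assms by (intro mult_right_mono) auto
    then have "deriv f x * (u * B - K) \<le> deriv f x * B"
      using deriv_f_pos[OF assms(1)] \<open>0 \<le> K\<close> by (intro mult_left_mono) auto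
    then have "(a * f x) * (deriv f x * (u * B - K)) \<le> (a * f x) * (deriv f x * B)"
      using assms(1,2) f_pos[of x] by - (rule mult_left_mono, auto)
    also have "\<dots> \<le> (a * f x + b) * (deriv f x * B)"
      using assms(1,3,5) deriv_f_pos[of x] by (intro mult_right_mono) auto
    finally show "(a * f x) * (deriv f x * (u * B - K)) \<le> (a * f x + b) * (deriv f x * B)" .
  qed simp
  also have "\<dots> = p * (1 - p) * deriv f x"
  proof -
    have "1 - p = B / ?S"
      using S by (simp add: p_def field_simps)
    then show ?thesis
      by (simp add: p_def)
  qed
  finally show ?thesis .
qed

text \<open>The total score is normalized to 1 at effort \<open>x\<close>. The gain in recognition
  is bounded by its tangent in the total score \<open>s\<close> at 1, then by the tangent of
  \<open>f\<close> at \<open>x\<close>; the first-order condition turns this into the tangent of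
  \<open>c\<close>, which lies below \<open>c\<close>.\<close>

lemma first_order_sufficient:
  assumes "0 < x" "0 < p" "p < 1" "0 \<le> y"
    and foc: "deriv c x * f x = p * (1 - p) * deriv f x"
  shows "p / f x * f y / (p / f x * f y + (1 - p)) - c y \<le> p - c x"
proof -
  define s where "s = p / f x * f y + (1 - p)"
  have fx: "0 < f x" and fy: "0 \<le> f y"
    using assms f_pos f_nonneg by auto
  have s: "0 < s"
    using assms fx fy by (auto simp: s_def intro!: add_nonneg_pos)
  \<comment> \<open>This square yields \<open>2 - s \<le> 1 / s\<close>, the tangent of the convex
    function \<open>1 / s\<close> at 1.\<close>
  have "0 \<le> (1 - s)\<^sup>2 / s"
    using s by simp
  then have "2 - s \<le> 1 / s"
    using s by (simp add: power2_eq_square field_simps)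
  then have "(1 - p) * (2 - s) \<le> (1 - p) * (1 / s)"
    using assms by (intro mult_left_mono) auto
  moreover have "(s - (1 - p)) / s = 1 - (1 - p) * (1 / s)"
    using s by (simp add: field_simps)
  ultimately have "(s - (1 - p)) / s - p \<le> (1 - p) * (s - 1)"
    by (simp only:) (simp add: algebra_simps)
  also have "\<dots> = p * (1 - p) / f x * (f y - f x)"
    using fx by (simp add: s_def field_simps)
  also have "\<dots> \<le> p * (1 - p) / f x * (deriv f x * (y - x))"
    using f_below_tangent[of x y] assms fx by (intro mult_left_mono) auto
  also have "\<dots> = deriv c x * (y - x)"
  proof -
    have "deriv c x = p * (1 - p) * deriv f x / f x"
      using foc fx by (simp add: field_simps)
    then show ?thesis
      by simp
  qed
  also have "\<dots> \<le> c y - c x"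
    using c_above_tangent[of x y] assms by simp
  finally show ?thesis
    by (simp add: s_def)
qed

end

section \<open>Equilibrium under the dictatorial rule\<close>

text \<open>With quota 1 the votes decide nothing, but \<open>stage_undominated_voting\<close> still
  prescribes them: the threshold is the discounted equilibrium payoff, as \<open>payoff_eq\<close>
  confirms below.\<close>

definition dictatorial_profile ::
  "('n::finite) game \<Rightarrow> ('n \<Rightarrow> real) \<Rightarrow> 'n \<Rightarrow> 'n strategy" where
  "dictatorial_profile G x i =
     \<lparr>effort = (\<lambda>_. x i), propose = (\<lambda>_ _. return_pmf (\<lambda>j. if j = i then 1 else 0)),
      vote = (\<lambda>_ _ _ s. discount G i * (recognition G x i - cost G i (x i)) \<le> s i)\<rparr>"

text \<open>The proposer is always among the supporters, which already meets the quota.\<close>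

lemma approved_dictatorial: "quota G = 1 \<Longrightarrow> approved G (supporters \<sigma> h x j s)"
  by (simp add: approved_def supporters_def Suc_le_eq card_gt_0_iff)

lemma at_proposal_dictatorial:
  "quota G = 1 \<Longrightarrow>
    at_proposal G \<sigma> g w h x j = (\<integral>\<^sup>+ s. g s \<partial>measure_pmf (propose (\<sigma> j) h x))"
  by (simp add: at_proposal_def at_vote_def approved_dictatorial)

lemma expected_share_le_1:
  assumes "feasible \<tau>"
  shows "(\<integral>\<^sup>+ s. ennreal (s i) \<partial>measure_pmf (propose \<tau> h x)) \<le> 1"
proof -
  have "s i \<le> 1" if "s \<in> set_pmf (propose \<tau> h x)" for s
    using assms that by (intro simplex_le_1) (auto simp: feasible_def)
  then have "(\<integral>\<^sup>+ s. ennreal (s i) \<partial>measure_pmf (propose \<tau> h x)) \<le>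
      (\<integral>\<^sup>+ s. 1 \<partial>measure_pmf (propose \<tau> h x))"
    by (intro nn_integral_mono_AE AE_pmfI) simp
  then show ?thesis
    by simp
qed

text \<open>Every profile, deviations included, ends the game in the current period.
  History-dependent deviations thus matter only through current effort and current proposal, and the
  one-period condition \<open>opt\<close> suffices.\<close>

lemma sspe_dictatorial_profile:
  fixes G :: "('n::finite) game"
  assumes quota: "quota G = 1"
    and x: "\<And>i. 0 \<le> x i"
    and cost: "\<And>i y. 0 \<le> y \<Longrightarrow> 0 \<le> cost G i y"
    and score: "\<And>y j. (\<And>l. 0 \<le> y l) \<Longrightarrow> 0 \<le> score G y j"
    and opt: "\<And>i y. 0 \<le> y \<Longrightarrow>
      recognition G (x(i := y)) i - cost G i y \<le> recognition G x i - cost G i (x i)"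
  shows "sspe G (dictatorial_profile G x)"
proof -
  define \<sigma> where "\<sigma> = dictatorial_profile G x"
  have eff: "efforts \<sigma> h = x" for h
    by (simp add: efforts_def \<sigma>_def dictatorial_profile_def)
  have feas: "feasible (\<sigma> i)" for i
    using x by (auto simp: feasible_def \<sigma>_def dictatorial_profile_def prob_simplex_def)
  define E where "E \<rho> h y i j = (\<integral>\<^sup>+ s. ennreal (s i) \<partial>measure_pmf (propose (\<rho> j) h y))"
    for \<rho> :: "'n \<Rightarrow> 'n strategy" and h y i j
  have E: "E \<sigma> h y i j = (if j = i then 1 else 0)" for h y i j
    by (auto simp: E_def \<sigma>_def dictatorial_profile_def)
  \<comment> \<open>A deviator gets at most the dollar as proposer, and nothing from the others, who
    still keep everything.\<close>
  have E_dev: "E (\<sigma>(i := \<tau>)) h y i j \<le> (if j = i then 1 else 0)" if "feasible \<tau>" for \<tau> h y i j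
    using expected_share_le_1[OF that, of h y i] E[of h y i j] by (auto simp: E_def)
  have share: "total_share G \<rho> i h =
      (\<Sum>j\<in>UNIV. ennreal (recognition G (efforts \<rho> h) j) * E \<rho> h (efforts \<rho> h) i j)" for \<rho> i h
    unfolding total_share_unfold[of G \<rho> i h] at_recognition_def at_proposal_dictatorial[OF quota] E_def ..
  have total_cost: "total_cost G \<rho> i h = ennreal (cost G i (effort (\<rho> i) h))" for \<rho> i h
    unfolding total_cost_unfold[of G \<rho> i h] at_recognition_def at_proposal_dictatorial[OF quota] by simp
  have payoff_eq: "payoff G \<sigma> i h = ereal (recognition G x i - cost G i (x i))" for i h
  proof -
    have "total_share G \<sigma> i h = ennreal (recognition G x i)"
      unfolding share eff E by (simp add: if_distrib cong: if_cong)
    moreover have "effort (\<sigma> i) h = x i"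
      by (simp add: \<sigma>_def dictatorial_profile_def)
    ultimately show ?thesis
      using recognition_nonneg[OF score[OF x]] cost[OF x] by (simp add: payoff_def total_cost)
  qed
  have payoff_le: "payoff G (\<sigma>(i := \<tau>)) i h \<le> payoff G \<sigma> i h" if "feasible \<tau>" for \<tau> i h
  proof -
    define y where "y = effort \<tau> h"
    have y: "0 \<le> y"
      using that by (simp add: y_def feasible_def)
    have dev: "efforts (\<sigma>(i := \<tau>)) h = x(i := y)"
      using eff[of h] by (auto simp: efforts_def y_def fun_eq_iff)
    have rec: "0 \<le> recognition G (x(i := y)) j" for j
      using x y by (intro recognition_nonneg score) auto
    have "total_share G (\<sigma>(i := \<tau>)) i h \<le>
        (\<Sum>j\<in>UNIV. ennreal (recognition G (x(i := y)) j) * (if j = i then 1 else 0))"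
      unfolding share dev using E_dev[OF that] by (intro sum_mono mult_left_mono) auto
    then have "total_share G (\<sigma>(i := \<tau>)) i h \<le> ennreal (recognition G (x(i := y)) i)"
      by (simp add: if_distrib cong: if_cong)
    then have "enn2ereal (total_share G (\<sigma>(i := \<tau>)) i h) \<le> ereal (recognition G (x(i := y)) i)"
      using rec[of i] by (simp add: less_eq_ennreal.rep_eq)
    moreover have "total_cost G (\<sigma>(i := \<tau>)) i h = ennreal (cost G i y)"
      by (simp add: total_cost y_def)
    ultimately have "payoff G (\<sigma>(i := \<tau>)) i h \<le> ereal (recognition G (x(i := y)) i) - ereal (cost G i y)"
      using cost[OF y] unfolding payoff_def by (intro ereal_minus_mono) auto
    also have "\<dots> \<le> payoff G \<sigma> i h"
      using opt[OF y] by (simp add: payoff_eq)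
    finally show ?thesis .
  qed
  have "proposal_payoff G (\<sigma>(i := \<tau>)) i h y j \<le> proposal_payoff G \<sigma> i h y j"
    if "feasible \<tau>" for \<tau> i h y j
    using E_dev[OF that, of i h y j] E[of h y i j]
    unfolding proposal_payoff_def at_proposal_dictatorial[OF quota] E_def[symmetric]
    by (intro ereal_minus_mono) (auto simp: less_eq_ennreal.rep_eq)
  moreover have "vote_payoff G (\<sigma>(i := \<tau>)) i h y j s \<le> vote_payoff G \<sigma> i h y j s" for \<tau> i h y j s
    by (simp add: vote_payoff_def at_vote_def approved_dictatorial[OF quota])
  ultimately have "subgame_perfect G \<sigma>"
    using feas payoff_le by (auto simp: subgame_perfect_def)
  moreover have "stationary \<sigma>"
    unfolding stationary_def \<sigma>_def dictatorial_profile_def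
    by (simp only: strategy.simps) (intro allI exI conjI; rule refl)
  moreover have "stage_undominated_voting G \<sigma>"
    unfolding stage_undominated_voting_def payoff_eq
    by (simp add: \<sigma>_def dictatorial_profile_def)
  ultimately show ?thesis
    by (simp add: sspe_def \<sigma>_def)
qed

section \<open>Optimality of the dictatorial rule\<close>

text \<open>Coordinates are raised from \<open>x\<close> to \<open>z\<close> one at a time; the
  intermediate profiles stay nonnegative, as \<open>mono\<close> demands.\<close>

lemma coordinatewise_mono:
  fixes L :: "('n::finite \<Rightarrow> real) \<Rightarrow> real"
  assumes mono: "\<And>y i z. (\<And>j. 0 \<le> y j) \<Longrightarrow> y i \<le> z \<Longrightarrow> L y \<le> L (y(i := z))"
    and "\<And>i. 0 \<le> x i" "\<And>i. x i \<le> z i"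
  shows "L x \<le> L z"
proof -
  have "L x \<le> L (\<lambda>i. if i \<in> A then z i else x i)" if "finite A" for A
    using that
  proof (induction A)
    case (insert a A)
    let ?y = "\<lambda>i. if i \<in> A then z i else x i"
    have "0 \<le> z i" for i
      using assms(2,3) order_trans by blast
    then have "L ?y \<le> L (?y(a := z a))"
      using assms(2,3) insert.hyps by (intro mono) auto
    also have "?y(a := z a) = (\<lambda>i. if i \<in> insert a A then z i else x i)"
      by auto
    finally show ?case
      using insert.IH by simp
  qed simp
  from this[of UNIV] show ?thesis
    by simp
qed

lemma sum_fun_upd:
  fixes g :: "'n::finite \<Rightarrow> real \<Rightarrow> real"
  shows "(\<Sum>j\<in>UNIV. g j ((x(i := y)) j)) = g i y + (\<Sum>j\<in>UNIV - {i}. g j (x j))"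
  by (simp add: sum.remove[of _ i])

lemma sspe_first_order:
  fixes G :: "('n::finite) game"
  assumes \<sigma>: "sspe G \<sigma>"
    and \<delta>: "0 < discount G i" "discount G i < 1"
    and contestant: "\<And>j. contestant (impact G j) (cost G j)"
    and bias: "\<And>j. 0 \<le> bias G j" and headstart: "\<And>j. 0 \<le> headstart G j"
  defines "x \<equiv> efforts \<sigma> []" and "p \<equiv> recognition G (efforts \<sigma> [])"
  assumes pos: "0 < x i"
  shows "deriv (cost G i) (x i) * impact G i (x i) \<le> p i * (1 - p i) * deriv (impact G i) (x i)"
proof -
  interpret contestant "impact G i" "cost G i"
    by (rule contestant)
  have score: "0 \<le> score G y j" if "\<And>l. 0 \<le> y l" for y j
    using that contestant.f_nonneg[OF contestant] bias headstart by (simp add: score_def)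
  have x: "0 \<le> x j" for j
    using \<sigma> by (auto simp: x_def efforts_def sspe_def subgame_perfect_def feasible_def)
  obtain U where U: "\<And>j. 0 \<le> U j" "\<And>j. U j \<le> 1"
    and opt: "\<And>y. 0 \<le> y \<Longrightarrow> (\<Sum>j\<in>UNIV. recognition G (x(i := y)) j * U j) - cost G i y
      \<le> (\<Sum>j\<in>UNIV. recognition G x j * U j) - cost G i (x i)"
    using sspe_effort_optimal[OF \<sigma> \<delta> c_nonneg c_zero score] unfolding x_def by blast
  define a where "a = bias G i"
  define b where "b = headstart G i"
  define B where "B = (\<Sum>j\<in>UNIV - {i}. score G x j)"
  define K where "K = (\<Sum>j\<in>UNIV - {i}. score G x j * U j)"
  have ab: "0 \<le> a" "0 \<le> b"
    using bias headstart by (auto simp: a_def b_def)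
  have BK: "0 \<le> B" "0 \<le> K"
    using score[OF x] U by (auto simp: B_def K_def intro!: sum_nonneg)
  have total: "(\<Sum>j\<in>UNIV. score G (x(i := y)) j) = a * impact G i y + b + B" for y
    using sum_fun_upd[of "\<lambda>j z. bias G j * impact G j z + headstart G j" x i y]
    by (simp add: score_def a_def b_def B_def)
  have x_upd: "x(i := x i) = x"
    by simp
  have p_i: "p i = (a * impact G i (x i) + b) / (a * impact G i (x i) + b + B)"
    if "0 < a * impact G i (x i) + b + B"
    using that total[of "x i"] unfolding x_upd p_def x_def[symmetric]
    by (simp add: recognition_def score_def a_def b_def)
  have reward: "(\<Sum>j\<in>UNIV. recognition G (x(i := y)) j * U j) =
      ((a * impact G i y + b) * U i + K) / (a * impact G i y + b + B)"
    if "0 < a * impact G i y + b + B" for y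
  proof -
    have "(\<Sum>j\<in>UNIV. recognition G (x(i := y)) j * U j) =
        (\<Sum>j\<in>UNIV. score G (x(i := y)) j * U j) / (a * impact G i y + b + B)"
      using that by (simp add: recognition_def total sum_divide_distrib)
    also have "(\<Sum>j\<in>UNIV. score G (x(i := y)) j * U j) = (a * impact G i y + b) * U i + K"
      using sum_fun_upd[of "\<lambda>j z. (bias G j * impact G j z + headstart G j) * U j" x i y]
      by (simp add: score_def a_def b_def K_def)
    finally show ?thesis .
  qed
  show ?thesis
  proof (cases "0 < a * impact G i (x i) + b + B")
    case True
    have S: "0 < a * impact G i y + b + B" if "0 < y" for y
    \<comment> \<open>With zero bias the total score does not depend on own effort; with positive
      bias any positive effort makes it positive.\<close>
    proof (cases "a = 0")
      case False
      then have "0 < a * impact G i y"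
        using ab f_pos[OF that] by simp
      then show ?thesis
        using ab BK by linarith
    qed (use True in simp)
    have "((a * impact G i y + b) * U i + K) / (a * impact G i y + b + B) - cost G i y \<le>
        ((a * impact G i (x i) + b) * U i + K) / (a * impact G i (x i) + b + B) - cost G i (x i)"
      if "0 < y" for y
      using opt[of y] reward[OF S[OF that]] reward[OF True] that by simp
    from first_order_necessary[OF pos ab BK(2,1) U(2)[of i] True this] show ?thesis
      by (simp add: p_i[OF True])
  next
    case False
    \<comment> \<open>A vanishing total score forces zero bias since \<open>x i > 0\<close>. Effort
      is then pure waste, and dropping it to 0 is a profitable deviation.\<close>
    have "0 \<le> a * impact G i (x i)"
      using ab f_pos[OF pos] by simp
    then have zero: "a * impact G i (x i) = 0" "b = 0" "B = 0"
      using False ab BK by linarith+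
    then have "a = 0"
      using f_pos[OF pos] by simp
    then have "score G (x(i := 0)) j = score G x j" for j
      by (cases "j = i") (auto simp: score_def a_def)
    then have "recognition G (x(i := 0)) j = recognition G x j" for j
      by (simp add: recognition_def)
    then have "cost G i (x i) \<le> 0"
      using opt[of 0] c_zero by simp
    then show ?thesis
      using c_pos[OF pos] by simp
  qed
qed

text \<open>The assumption \<open>nondegenerate\<close> matters because certain recognition cannot
  be reproduced without headstarts: a positive effort could be lowered without losing recognition,
  and zero effort does not win for sure.\<close>

theorem theorem2:
  fixes \<delta> \<alpha> \<beta> x p :: "'n::finite \<Rightarrow> real"
    and f c :: "'n \<Rightarrow> real \<Rightarrow> real"
    and \<Lambda> :: "('n \<Rightarrow> real) \<Rightarrow> ('n \<Rightarrow> real) \<Rightarrow> real"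
    and k :: nat
  assumes agents: "2 \<le> CARD('n)"
    and discount: "\<forall>i. 0 < \<delta> i \<and> \<delta> i < 1"
    and impact_nonneg: "\<forall>i. \<forall>y\<ge>0. 0 \<le> f i y"
    and impact_zero: "\<forall>i. f i 0 = 0"
    and impact_continuous: "\<forall>i. continuous_on {0..} (f i)"
    and impact_smooth: "\<forall>i. \<forall>y>0. f i differentiable at y \<and> deriv (f i) differentiable at y"
    and impact_increasing: "\<forall>i. \<forall>y>0. 0 < deriv (f i) y"
    and impact_concave: "\<forall>i. \<forall>y>0. deriv (deriv (f i)) y \<le> 0"
    and cost_nonneg: "\<forall>i. \<forall>y\<ge>0. 0 \<le> c i y"
    and cost_zero: "\<forall>i. c i 0 = 0"
    and cost_continuous: "\<forall>i. continuous_on {0..} (c i)"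
    and cost_smooth: "\<forall>i. \<forall>y>0. c i differentiable at y \<and> deriv (c i) differentiable at y"
    and cost_increasing: "\<forall>i. \<forall>y>0. 0 < deriv (c i) y"
    and cost_convex: "\<forall>i. \<forall>y>0. 0 \<le> deriv (deriv (c i)) y"
    and objective_mono: "\<forall>q\<in>prob_simplex. \<forall>y. (\<forall>j. 0 \<le> y j) \<longrightarrow>
      (\<forall>i. \<forall>z\<ge>y i. \<Lambda> y q \<le> \<Lambda> (y(i := z)) q)"
    and bias: "\<forall>i. 0 \<le> \<alpha> i" "\<alpha> \<noteq> (\<lambda>_. 0)"
    and headstart: "\<forall>i. 0 \<le> \<beta> i"
    and quota: "1 \<le> k" "k \<le> CARD('n)"
    and outcome: "sspe_outcome \<lparr>discount = \<delta>, impact = f, cost = c,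
      bias = \<alpha>, headstart = \<beta>, quota = k\<rparr> x p"
    and nondegenerate: "\<forall>i. p i < 1"
  shows "\<exists>\<alpha>'. (\<forall>i. 0 \<le> \<alpha>' i) \<and> \<alpha>' \<noteq> (\<lambda>_. 0) \<and>
    (\<exists>x' p'. sspe_outcome \<lparr>discount = \<delta>, impact = f, cost = c,
      bias = \<alpha>', headstart = (\<lambda>_. 0), quota = 1\<rparr> x' p' \<and> \<Lambda> x p \<le> \<Lambda> x' p')"
proof -
  let ?G = "\<lparr>discount = \<delta>, impact = f, cost = c, bias = \<alpha>, headstart = \<beta>, quota = k\<rparr>"
  have con: "contestant (f i) (c i)" for i
    by (intro contestant.intro impact_zero[rule_format] impact_continuous[rule_format]
        impact_smooth[rule_format, THEN conjunct1] impact_smooth[rule_format, THEN conjunct2]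
        impact_increasing[rule_format] impact_concave[rule_format]
        cost_zero[rule_format] cost_continuous[rule_format]
        cost_smooth[rule_format, THEN conjunct1] cost_smooth[rule_format, THEN conjunct2]
        cost_increasing[rule_format] cost_convex[rule_format])
  obtain \<sigma> where \<sigma>: "sspe ?G \<sigma>" and x_eq: "x = efforts \<sigma> []" and p_eq: "p = recognition ?G x"
    using outcome by (auto simp: sspe_outcome_def)
  have x: "0 \<le> x i" for i
    using \<sigma> by (auto simp: x_eq efforts_def sspe_def subgame_perfect_def feasible_def)
  have score: "0 \<le> score ?G x i" for i
    using x impact_nonneg bias(1) headstart by (simp add: score_def)
  have p: "p \<in> prob_simplex"
    unfolding p_eq using score by (rule recognition_in_simplex)
  then have p_nonneg: "0 \<le> p i" and p_sum: "(\<Sum>i\<in>UNIV. p i) = 1" for i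
    by (auto simp: prob_simplex_def)
  have foc: "deriv (c i) (x i) * f i (x i) \<le> p i * (1 - p i) * deriv (f i) (x i)" if "0 < x i" for i
    using sspe_first_order[OF \<sigma>, of i] discount con bias(1) headstart that
    by (simp add: x_eq p_eq)
  have "\<exists>y. x i \<le> y \<and> (p i = 0 \<longrightarrow> y = 0) \<and>
      (0 < p i \<longrightarrow> 0 < y \<and> deriv (c i) y * f i y = p i * (1 - p i) * deriv (f i) y)" for i
  proof -
    interpret contestant "f i" "c i"
      by (rule con)
    show ?thesis
    proof (cases "p i = 0")
      case True
      have "\<not> 0 < x i"
      proof
        \<comment> \<open>The right side of \<open>foc\<close> would be 0 while its left side is
          positive.\<close>
        assume pos: "0 < x i"
        show False
          using foc[OF pos] mult_pos_pos[OF deriv_c_pos[OF pos] f_pos[OF pos]] True by simp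
      qed
      then show ?thesis
        using True by (intro exI[of _ 0]) auto
    next
      case False
      then have t: "0 < p i * (1 - p i)"
        using p_nonneg[of i] nondegenerate by simp
      then obtain y where "0 < y" "deriv (c i) y * f i y = p i * (1 - p i) * deriv (f i) y"
        using first_order_solution by blast
      moreover from this have "x i \<le> y"
        using first_order_le[of "x i" y, OF _ _ less_imp_le[OF t] foc] by (cases "0 < x i") auto
      ultimately show ?thesis
        using False by blast
    qed
  qed
  then obtain x' where x': "\<And>i. x i \<le> x' i" "\<And>i. p i = 0 \<Longrightarrow> x' i = 0"
    and x'_pos: "\<And>i. 0 < p i \<Longrightarrow> 0 < x' i"
    and x'_foc: "\<And>i. 0 < p i \<Longrightarrow>
      deriv (c i) (x' i) * f i (x' i) = p i * (1 - p i) * deriv (f i) (x' i)"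
    by metis
  have x'_nonneg: "0 \<le> x' i" for i
    using x x'(1) order_trans by blast
  \<comment> \<open>The score at \<open>x' i\<close> becomes \<open>p i\<close>, so total score is
    1. If \<open>p i = 0\<close>, then \<open>f i (x' i) = 0\<close> as well, and the quotient is 0
    by the convention on division by zero.\<close>
  define \<alpha>' where "\<alpha>' i = p i / f i (x' i)" for i
  let ?H = "\<lparr>discount = \<delta>, impact = f, cost = c, bias = \<alpha>', headstart = (\<lambda>_. 0), quota = 1\<rparr>"
  have \<alpha>': "0 \<le> \<alpha>' i" for i
    using p_nonneg impact_nonneg x'_nonneg by (simp add: \<alpha>'_def)
  have score': "\<alpha>' i * f i (x' i) = p i" for i
    using contestant.f_pos[OF con x'_pos, of i i] p_nonneg[of i]
    by (cases "p i = 0") (auto simp: \<alpha>'_def)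
  have total: "(\<Sum>j\<in>UNIV. score ?H (x'(i := y)) j) = \<alpha>' i * f i y + (1 - p i)" for i y
  proof -
    have "(\<Sum>j\<in>UNIV - {i}. p j) = 1 - p i"
      using p_sum by (simp add: sum_diff1)
    then show ?thesis
      using sum_fun_upd[of "\<lambda>j z. \<alpha>' j * f j z" x' i y] by (simp add: score_def score')
  qed
  have rec_dev: "recognition ?H (x'(i := y)) i = \<alpha>' i * f i y / (\<alpha>' i * f i y + (1 - p i))"
    if "0 \<le> y" for i y
  proof -
    \<comment> \<open>The opponents' score \<open>1 - p i\<close> is positive, so the uniform tie
      rule never applies, not even at \<open>y = 0\<close>.\<close>
    have "0 < \<alpha>' i * f i y + (1 - p i)"
      using \<alpha>' impact_nonneg nondegenerate that by (intro add_nonneg_pos) auto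
    then show ?thesis
      unfolding recognition_def total by (simp add: score_def)
  qed
  have rec: "recognition ?H x' = p"
  proof
    show "recognition ?H x' i = p i" for i
      using rec_dev[OF x'_nonneg, of i i] by (simp add: score')
  qed
  have "sspe ?H (dictatorial_profile ?H x')"
  proof (rule sspe_dictatorial_profile)
    fix i and y :: real
    assume y: "0 \<le> y"
    interpret contestant "f i" "c i"
      by (rule con)
    show "recognition ?H (x'(i := y)) i - cost ?H i y \<le> recognition ?H x' i - cost ?H i (x' i)"
    proof (cases "p i = 0")
      case True
      then show ?thesis
        using c_nonneg[OF y] x'(2)[OF True] c_zero
        unfolding rec_dev[OF y] rec by (simp add: \<alpha>'_def)
    next
      case False
      then have "0 < p i"
        using p_nonneg[of i] by simp
      from first_order_sufficient[OF x'_pos[OF this] this _ y x'_foc[OF this]] nondegenerate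
      show ?thesis
        unfolding rec_dev[OF y] rec by (simp add: \<alpha>'_def)
    qed
  qed (use x'_nonneg cost_nonneg impact_nonneg \<alpha>' in \<open>auto simp: score_def\<close>)
  moreover have "efforts (dictatorial_profile ?H x') [] = x'"
    by (simp add: efforts_def dictatorial_profile_def)
  ultimately have "sspe_outcome ?H x' p"
    unfolding sspe_outcome_def using rec by metis
  \<comment> \<open>Both outcomes share the profile \<open>p\<close>, so monotonicity in efforts
    alone compares them.\<close>
  moreover have "\<Lambda> x p \<le> \<Lambda> x' p"
  proof (rule coordinatewise_mono[of "\<lambda>y. \<Lambda> y p"])
    show "\<Lambda> y p \<le> \<Lambda> (y(i := z)) p" if "\<And>j. 0 \<le> y j" "y i \<le> z" for y i z
      using objective_mono p that by blast
  qed (rule x x'(1))+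
  moreover have "\<alpha>' \<noteq> (\<lambda>_. 0)"
  proof
    assume "\<alpha>' = (\<lambda>_. 0)"
    then have "p i = 0" for i
      using score'[of i] by simp
    then show False
      using p_sum by simp
  qed
  ultimately show ?thesis
    using \<alpha>' by blast
qed

end
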